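(* Let $F$ be an analytic function defined in a neighbourhood of $0\in\mathbb{C}$, with $|F'|\neq1$ there, such that $F(0)=0$, $F'(0)\neq0$ and $F''(0)\neq0$. Let $K$ be the Gaussian curvature of the modular surface in $\mathbb{E}_1^3$ induced by $F$. Then $K(0)$ is undefined; however, in some deleted neighbourhood of the origin $z=0$ there is one region of positive Gaussian curvature and one region of negative Gaussian curvature, separated by two curves of zero Gaussian curvature emanating from the origin.
   Context: $\mathbb{E}_1^3$ denotes $\mathbb{R}^3$ with the Lorentzian metric $dx^2+dy^2-dt^2$; $(x,y)$ is identified with $z=x+iy$. The modular surface induced by an analytic function $F$ is the graph $(x,y,h(x,y))$ with $h=|F|$. Its Gaussian curvature in $\mathbb{E}_1^3$, as a function of $z$, is $$K=-\frac{h_{xx}h_{yy}-h_{xy}^2}{(1-h_x^2-h_y^2)^2},$$ which where $F\neq0$ and $|F'|\neq1$ equals $-\dfrac{|F'|^4-|2FF''-(F')^2|^2}{4|F|^2(1-|F'|^2)^2}$; "$K(0)$ is undefined" is asserted on the basis of this last formula at a point where $F=0$. $F$ is not required to be the square of an analytic function. Regions and curves are understood as subsets of the $z$-plane (parameter domain). *)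

theory Defs
  imports "HOL-Complex_Analysis.Complex_Analysis"
begin

text \<open>Real functions on the \<open>(x,y)\<close>-plane are functions of \<open>z = x + \<i>y\<close>.\<close>

definition has_partial_x :: "(complex \<Rightarrow> real) \<Rightarrow> real \<Rightarrow> complex \<Rightarrow> bool" where
  "has_partial_x h d z \<longleftrightarrow> ((\<lambda>t. h (z + of_real t)) has_real_derivative d) (at 0)"

definition has_partial_y :: "(complex \<Rightarrow> real) \<Rightarrow> real \<Rightarrow> complex \<Rightarrow> bool" where
  "has_partial_y h d z \<longleftrightarrow> ((\<lambda>t. h (z + \<i> * of_real t)) has_real_derivative d) (at 0)"

text \<open>The Gaussian curvature at \<open>z\<close> of the graph of \<open>h\<close> in \<open>\<real>\<^sup>3\<close> with the metric
  \<open>dx\<^sup>2 + dy\<^sup>2 - dt\<^sup>2\<close> is defined and equal to \<open>k\<close>. A relation is used because the curvature is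
  a partial function: it is undefined where one of the partial derivatives in the formula does
  not exist or the denominator vanishes. As usual, \<open>h\<^sub>x\<^sub>y\<close> is the \<open>y\<close>-derivative of \<open>h\<^sub>x\<close>.\<close>

definition has_lorentz_curvature :: "(complex \<Rightarrow> real) \<Rightarrow> complex \<Rightarrow> real \<Rightarrow> bool" where
  "has_lorentz_curvature h z k \<longleftrightarrow>
     (\<exists>hx hy hxx hxy hyy.
        (\<forall>\<^sub>F w in nhds z. has_partial_x h (hx w) w \<and> has_partial_y h (hy w) w) \<and>
        has_partial_x hx hxx z \<and> has_partial_y hx hxy z \<and> has_partial_y hy hyy z \<and>
        1 - (hx z)\<^sup>2 - (hy z)\<^sup>2 \<noteq> 0 \<and>
        k = - (hxx * hyy - hxy\<^sup>2) / (1 - (hx z)\<^sup>2 - (hy z)\<^sup>2)\<^sup>2)"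

definition modular_surface :: "(complex \<Rightarrow> complex) \<Rightarrow> complex \<Rightarrow> real" where
  "modular_surface F z = cmod (F z)"

lemma has_partial_x_cong:
  assumes "\<forall>\<^sub>F w in nhds z. f w = g w" and "has_partial_x f d z"
  shows "has_partial_x g d z"
proof -
  have "isCont (\<lambda>t::real. z + of_real t) 0"
    by simp
  then have "filterlim (\<lambda>t::real. z + of_real t) (nhds z) (nhds 0)"
    using tendsto_at_iff_tendsto_nhds[of "\<lambda>t::real. z + of_real t" 0] by (simp add: isCont_def)
  then have "\<forall>\<^sub>F t in nhds (0::real). f (z + of_real t) = g (z + of_real t)"
    by (rule eventually_compose_filterlim[OF assms(1)])
  from DERIV_cong_ev[OF refl this refl] show ?thesis
    using assms(2) unfolding has_partial_x_def by simp
qed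

lemma has_partial_y_cong:
  assumes "\<forall>\<^sub>F w in nhds z. f w = g w" and "has_partial_y f d z"
  shows "has_partial_y g d z"
proof -
  have "isCont (\<lambda>t::real. z + \<i> * of_real t) 0"
    by simp
  then have "filterlim (\<lambda>t::real. z + \<i> * of_real t) (nhds z) (nhds 0)"
    using tendsto_at_iff_tendsto_nhds[of "\<lambda>t::real. z + \<i> * of_real t" 0] by (simp add: isCont_def)
  then have "\<forall>\<^sub>F t in nhds (0::real). f (z + \<i> * of_real t) = g (z + \<i> * of_real t)"
    by (rule eventually_compose_filterlim[OF assms(1)])
  from DERIV_cong_ev[OF refl this refl] show ?thesis
    using assms(2) unfolding has_partial_y_def by simp
qed

lemma has_partial_x_unique: "has_partial_x h d z \<Longrightarrow> has_partial_x h d' z \<Longrightarrow> d = d'"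
  unfolding has_partial_x_def by (rule DERIV_unique)

lemma has_partial_y_unique: "has_partial_y h d z \<Longrightarrow> has_partial_y h d' z \<Longrightarrow> d = d'"
  unfolding has_partial_y_def by (rule DERIV_unique)

lemma has_lorentz_curvature_unique:
  assumes "has_lorentz_curvature h z k" and "has_lorentz_curvature h z k'"
  shows "k = k'"
proof -
  from assms(1) obtain hx hy hxx hxy hyy where
    1: "\<forall>\<^sub>F w in nhds z. has_partial_x h (hx w) w \<and> has_partial_y h (hy w) w"
      "has_partial_x hx hxx z" "has_partial_y hx hxy z" "has_partial_y hy hyy z"
      "k = - (hxx * hyy - hxy\<^sup>2) / (1 - (hx z)\<^sup>2 - (hy z)\<^sup>2)\<^sup>2"
    unfolding has_lorentz_curvature_def by (elim exE conjE)
  from assms(2) obtain hx' hy' hxx' hxy' hyy' where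
    2: "\<forall>\<^sub>F w in nhds z. has_partial_x h (hx' w) w \<and> has_partial_y h (hy' w) w"
      "has_partial_x hx' hxx' z" "has_partial_y hx' hxy' z" "has_partial_y hy' hyy' z"
      "k' = - (hxx' * hyy' - hxy'\<^sup>2) / (1 - (hx' z)\<^sup>2 - (hy' z)\<^sup>2)\<^sup>2"
    unfolding has_lorentz_curvature_def by (elim exE conjE)
  have ex: "\<forall>\<^sub>F w in nhds z. hx w = hx' w"
    using 1(1) 2(1) by eventually_elim (meson has_partial_x_unique)
  have ey: "\<forall>\<^sub>F w in nhds z. hy w = hy' w"
    using 1(1) 2(1) by eventually_elim (meson has_partial_y_unique)
  have "hxx = hxx'" by (rule has_partial_x_unique[OF has_partial_x_cong[OF ex 1(2)] 2(2)])
  moreover have "hxy = hxy'" by (rule has_partial_y_unique[OF has_partial_y_cong[OF ex 1(3)] 2(3)])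
  moreover have "hyy = hyy'" by (rule has_partial_y_unique[OF has_partial_y_cong[OF ey 1(4)] 2(4)])
  moreover have "hx z = hx' z" "hy z = hy' z"
    using eventually_nhds_x_imp_x[OF ex] eventually_nhds_x_imp_x[OF ey] by simp_all
  ultimately show ?thesis
    using 1(5) 2(5) by simp
qed

end

theory Submission
  imports Defs
begin

text \<open>
  Write \<open>a = F \<cdot> F''\<close> and \<open>b = F'\<^sup>2\<close>. Where \<open>F \<noteq> 0\<close> and \<open>\<bar>F'\<bar> \<noteq> 1\<close>, computing the first and second
  directional derivatives of \<open>\<bar>F\<bar>\<close> gives
  \<open>K = - Re (a \<cdot> cnj (b - a)) / (\<bar>F\<bar>\<^sup>2 (1 - \<bar>F'\<bar>\<^sup>2)\<^sup>2)\<close>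
  (\<open>modular_surface_curvature\<close>). This is the usual formula for \<open>K\<close>, because
  \<open>\<bar>b\<bar>\<^sup>2 - \<bar>2a - b\<bar>\<^sup>2 = 4 Re (a \<cdot> cnj (b - a))\<close>.
  Dividing by \<open>\<bar>b - a\<bar>\<^sup>2\<close> shows that \<open>K\<close> has the sign of \<open>- Re H\<close>, where \<open>H = a / (b - a)\<close>
  (\<open>modular_surface_curvature_sign\<close>).

  Near a simple zero of \<open>F\<close> with \<open>F'' \<noteq> 0\<close> the function \<open>H\<close> is holomorphic, and at the zero it has
  the value \<open>0\<close> and the derivative \<open>F'' / F' \<noteq> 0\<close>. So \<open>H\<close> is a local holomorphic coordinate, with
  inverse \<open>\<phi>\<close> on some closed disc around \<open>0\<close> (\<open>local_inverse_on_disc\<close>). In this coordinate the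
  picture is a disc cut along the imaginary axis: the curvature is positive in the left half disc,
  negative in the right one, and zero on the two open radii in between. It remains to carry this
  picture over by the topological embedding \<open>\<phi>\<close>; invariance of domain makes the images
  of open sets open, and the frontiers follow (\<open>frontier_image_half_disc\<close>, \<open>spoke_image_arc\<close>).

  At the zero itself the curvature is undefined, since \<open>\<bar>F\<bar>\<close> behaves like \<open>\<bar>F'\<bar>\<close> times the distance
  to the zero and so has a corner (\<open>modular_surface_no_partial_x\<close>).
\<close>

section \<open>Directional derivatives of the modulus of a holomorphic function\<close>

lemma has_vector_derivative_along_line:
  assumes "(f has_field_derivative d) (at z)"
  shows "((\<lambda>t. f (z + e * of_real t)) has_vector_derivative e * d) (at 0)"
proof -
  have "((\<lambda>t::real. z + e * of_real t) has_vector_derivative e) (at 0)"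
    by (auto intro!: derivative_eq_intros)
  from field_vector_diff_chain_at[OF this, of f d] assms show ?thesis
    by (simp add: o_def)
qed

lemma norm_has_real_derivative:
  fixes g :: "real \<Rightarrow> 'a::real_inner"
  assumes "(g has_vector_derivative g') (at t)" "g t \<noteq> 0"
  shows "((\<lambda>t. norm (g t)) has_real_derivative (g t \<bullet> g') / norm (g t)) (at t)"
proof -
  have "(norm has_derivative (\<lambda>h. h \<bullet> sgn (g t))) (at (g t))"
    using has_derivative_norm[OF assms(2)] by simp
  from has_derivative_compose[OF assms(1)[unfolded has_vector_derivative_def] this]
  have "((\<lambda>t. norm (g t)) has_derivative (\<lambda>h. (h *\<^sub>R g') \<bullet> sgn (g t))) (at t)" .
  then show ?thesis
    unfolding has_field_derivative_def
    by (rule has_derivative_eq_rhs)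
      (auto simp: sgn_div_norm inner_commute divide_inverse fun_eq_iff)
qed

lemma norm_along_line_has_real_derivative:
  assumes "(F has_field_derivative F') (at z)" "F z \<noteq> 0"
  shows "((\<lambda>t. norm (F (z + e * of_real t))) has_real_derivative
           Re (e * cnj (F z) * F') / norm (F z)) (at 0)"
proof -
  have "F z \<bullet> (e * F') = Re (e * cnj (F z) * F')"
    by (simp add: inner_complex_def algebra_simps)
  with norm_has_real_derivative[OF has_vector_derivative_along_line[OF assms(1), of e]] assms(2)
  show ?thesis by simp
qed

text \<open>Differentiating in the direction \<open>d\<close> the derivative in the direction \<open>e\<close>. Keeping both directions
  arbitrary gives all second partial derivatives of \<open>\<bar>F\<bar>\<close> at once: \<open>1\<close> is the \<open>x\<close>-direction
  and \<open>\<i>\<close> the \<open>y\<close>-direction.\<close>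

lemma hessian_of_norm_along_lines:
  assumes "(F has_field_derivative F' z) (at z)" "(F' has_field_derivative F'') (at z)" "F z \<noteq> 0"
  shows "((\<lambda>t. Re (e * cnj (F (z + d * of_real t)) * F' (z + d * of_real t))
                 / norm (F (z + d * of_real t))) has_real_derivative
           (Re (e * (cnj (d * F' z) * F' z + cnj (F z) * (d * F''))) / norm (F z)
             - Re (e * cnj (F z) * F' z) * Re (d * cnj (F z) * F' z) / norm (F z) ^ 3)) (at 0)"
proof -
  have "((\<lambda>t. cnj (F (z + d * of_real t))) has_vector_derivative cnj (d * F' z)) (at 0)"
    by (intro has_vector_derivative_cnj has_vector_derivative_along_line assms)
  note * = has_vector_derivative_mult[OF this has_vector_derivative_along_line[OF assms(2), of d]]
  have "((\<lambda>t. Re (e * (cnj (F (z + d * of_real t)) * F' (z + d * of_real t)))) has_real_derivative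
     Re (e * (cnj (F z) * (d * F'') + cnj (d * F' z) * F' z))) (at 0)"
    unfolding has_real_derivative_iff_has_vector_derivative
    using bounded_linear.has_vector_derivative[OF bounded_linear_Re
        has_vector_derivative_mult_right[OF *, of e]] by simp
  from DERIV_divide[OF this norm_along_line_has_real_derivative[of F "F' z" z d]] assms
  show ?thesis
    by (rule_tac DERIV_cong) (auto simp: field_simps power3_eq_cube)
qed

section \<open>The curvature of a modular surface\<close>

text \<open>With \<open>f = F z\<close>, \<open>p = F' z\<close> and \<open>q = F'' z\<close>, the number \<open>\<sigma> e d\<close> is \<open>\<bar>f\<bar>\<^sup>3\<close> times the second
  derivative of \<open>\<bar>F\<bar>\<close> at \<open>z\<close> in the directions \<open>e\<close> and \<open>d\<close>, so this is the determinant of the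
  Hessian, scaled by \<open>\<bar>f\<bar>\<^sup>6\<close>.
  In terms of \<open>A = cnj f \<cdot> p\<close> and \<open>B = cnj f \<cdot> q\<close> the terms of degree four in \<open>A\<close>, which come
  from \<open>(Re A \<cdot> Im A)\<^sup>2\<close>, cancel. This leaves \<open>\<bar>f\<bar>\<^sup>2 Re (cnj B \<cdot> A\<^sup>2) - \<bar>f\<bar>\<^sup>4 \<bar>B\<bar>\<^sup>2\<close>.\<close>

lemma hessian_numerator_identity:
  fixes f p q :: complex
  defines "\<sigma> \<equiv> \<lambda>e d. (cmod f)\<^sup>2 * Re (e * (cnj (d * p) * p + cnj f * (d * q)))
             - Re (e * cnj f * p) * Re (d * cnj f * p)"
  shows "\<sigma> 1 1 * \<sigma> \<i> \<i> - (\<sigma> 1 \<i>)\<^sup>2 = cmod f ^ 4 * Re (f * q * cnj (p\<^sup>2 - f * q))"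
proof -
  define A B N where "A = cnj f * p" and "B = cnj f * q" and "N = (cmod f)\<^sup>2"
  have normA: "N * (cmod p)\<^sup>2 = (Re A)\<^sup>2 + (Im A)\<^sup>2"
    unfolding cmod_power2[symmetric] A_def N_def norm_mult complex_mod_cnj power_mult_distrib ..
  have \<sigma>: "\<sigma> e d = Re (e * cnj d) * ((Re A)\<^sup>2 + (Im A)\<^sup>2) + N * Re (e * d * B) - Re (e * A) * Re (d * A)"
    for e d
  proof -
    have "e * (cnj (d * p) * p + cnj f * (d * q)) = of_real ((cmod p)\<^sup>2) * (e * cnj d) + e * d * B"
      unfolding complex_norm_square by (simp add: B_def algebra_simps)
    then have "Re (e * (cnj (d * p) * p + cnj f * (d * q))) = (cmod p)\<^sup>2 * Re (e * cnj d) + Re (e * d * B)"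
      by (simp only: plus_complex.sel Re_complex_of_real times_complex.sel Im_complex_of_real)
    then show ?thesis
      unfolding \<sigma>_def N_def[symmetric] normA[symmetric]
      by (simp only: A_def distrib_left mult.assoc mult.left_commute mult.commute[of "Re (e * cnj d)"])
  qed
  have \<sigma>s: "\<sigma> 1 1 = (Im A)\<^sup>2 + N * Re B" "\<sigma> \<i> \<i> = (Re A)\<^sup>2 - N * Re B" "\<sigma> 1 \<i> = Re A * Im A - N * Im B"
    unfolding \<sigma> by (simp_all add: power2_eq_square)
  have "\<sigma> 1 1 * \<sigma> \<i> \<i> - (\<sigma> 1 \<i>)\<^sup>2 = N * Re (cnj B * A\<^sup>2) - N\<^sup>2 * (cmod B)\<^sup>2"
    unfolding \<sigma>s cmod_power2 by (simp add: power2_eq_square algebra_simps)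
  also have "cnj B * A\<^sup>2 = of_real N * cnj (f * q * cnj (p\<^sup>2))"
    unfolding N_def complex_norm_square by (simp add: A_def B_def power2_eq_square)
  also have "Re \<dots> = N * Re (f * q * cnj (p\<^sup>2))"
    by (simp only: times_complex.sel[of "of_real N"] Re_complex_of_real Im_complex_of_real cnj.sel)
  also have "(cmod B)\<^sup>2 = Re (f * q * cnj (f * q))"
    unfolding complex_norm_square[symmetric] Re_complex_of_real by (simp add: B_def norm_mult)
  also have "N * (N * Re (f * q * cnj (p\<^sup>2))) - N\<^sup>2 * Re (f * q * cnj (f * q))
      = N\<^sup>2 * Re (f * q * cnj (p\<^sup>2 - f * q))"
    by (simp only: complex_cnj_diff right_diff_distrib minus_complex.sel power2_eq_square mult.assoc)
  finally show ?thesis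
    by (simp add: N_def)
qed

lemma modular_surface_curvature:
  assumes "open S" "F holomorphic_on S" "z \<in> S" "F z \<noteq> 0" "cmod (deriv F z) \<noteq> 1"
  shows "has_lorentz_curvature (modular_surface F) z
    (- Re (F z * deriv (deriv F) z * cnj ((deriv F z)\<^sup>2 - F z * deriv (deriv F) z))
       / ((cmod (F z))\<^sup>2 * (1 - (cmod (deriv F z))\<^sup>2)\<^sup>2))"
proof -
  define f p q where "f = F z" and "p = deriv F z" and "q = deriv (deriv F) z"
  define h where "h = cmod f"
  define g where "g e w = Re (e * cnj (F w) * deriv F w) / cmod (F w)" for e w
  define s where "s e d = Re (e * (cnj (d * p) * p + cnj f * (d * q))) / h
    - Re (e * cnj f * p) * Re (d * cnj f * p) / h ^ 3" for e d
  have D: "(F has_field_derivative deriv F w) (at w)" if "w \<in> S" for w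
    using that assms(1,2) holomorphic_derivI by blast
  have D': "(deriv F has_field_derivative q) (at z)"
    unfolding q_def using assms(1-3) holomorphic_derivI holomorphic_deriv by blast
  have "isCont F z"
    using D[OF assms(3)] by (rule DERIV_isCont)
  then have "filterlim F (nhds (F z)) (nhds z)"
    using tendsto_at_iff_tendsto_nhds[of F z] by (simp add: isCont_def)
  then have "\<forall>\<^sub>F w in nhds z. F w \<in> - {0}"
    using assms(4) by (intro topological_tendstoD) auto
  moreover have "\<forall>\<^sub>F w in nhds z. w \<in> S"
    using assms(1,3) eventually_nhds_in_open by blast
  ultimately have gradient: "\<forall>\<^sub>F w in nhds z. has_partial_x (modular_surface F) (g 1 w) w \<and>
      has_partial_y (modular_surface F) (g \<i> w) w"
  proof eventually_elim
    case (elim w)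
    then show ?case
      using norm_along_line_has_real_derivative[OF D[of w], of \<i>]
        norm_along_line_has_real_derivative[OF D[of w], of 1]
      unfolding has_partial_x_def has_partial_y_def modular_surface_def g_def by simp
  qed
  have "((\<lambda>t. g e (z + d * of_real t)) has_real_derivative s e d) (at 0)" for e d
    unfolding g_def s_def f_def p_def h_def
    by (rule hessian_of_norm_along_lines[OF D[OF assms(3)] D' assms(4)])
  from this[of 1 1] this[of 1 \<i>] this[of \<i> \<i>]
  have hessian: "has_partial_x (g 1) (s 1 1) z" "has_partial_y (g 1) (s 1 \<i>) z"
      "has_partial_y (g \<i>) (s \<i> \<i>) z"
    unfolding has_partial_x_def has_partial_y_def by simp_all
  \<comment> \<open>By the Cauchy-Riemann equations the gradient of \<open>\<bar>F\<bar>\<close> has the length \<open>\<bar>F'\<bar>\<close>.\<close>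
  have "h \<noteq> 0" and h2: "h\<^sup>2 = (Re f)\<^sup>2 + (Im f)\<^sup>2"
    using assms(4) by (simp_all add: h_def f_def cmod_power2)
  have "(Re (cnj f * p))\<^sup>2 + (Re (\<i> * cnj f * p))\<^sup>2 = h\<^sup>2 * (cmod p)\<^sup>2"
    unfolding h2 cmod_power2 by simp algebra
  then have gradient_norm: "1 - (g 1 z)\<^sup>2 - (g \<i> z)\<^sup>2 = 1 - (cmod p)\<^sup>2"
    using \<open>h \<noteq> 0\<close> unfolding g_def f_def[symmetric] p_def[symmetric] h_def[symmetric]
    by (simp add: power_divide diff_diff_eq add_divide_distrib[symmetric] del: times_complex.sel)
  have s_eq: "s e d = (h\<^sup>2 * Re (e * (cnj (d * p) * p + cnj f * (d * q)))
      - Re (e * cnj f * p) * Re (d * cnj f * p)) / h ^ 3" for e d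
    using \<open>h \<noteq> 0\<close> unfolding s_def by (simp add: field_simps power2_eq_square power3_eq_cube)
  have "s 1 1 * s \<i> \<i> - (s 1 \<i>)\<^sup>2 = h ^ 4 * Re (f * q * cnj (p\<^sup>2 - f * q)) / (h ^ 3)\<^sup>2"
    unfolding s_eq power_divide times_divide_times_eq power2_eq_square[of "h ^ 3"]
      diff_divide_distrib[symmetric]
    unfolding h_def hessian_numerator_identity ..
  also have "\<dots> = Re (f * q * cnj (p\<^sup>2 - f * q)) / h\<^sup>2"
    using \<open>h \<noteq> 0\<close> by (simp add: divide_simps power_mult[symmetric] power_add[symmetric])
  finally have det: "s 1 1 * s \<i> \<i> - (s 1 \<i>)\<^sup>2 = Re (f * q * cnj (p\<^sup>2 - f * q)) / h\<^sup>2" .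
  have "(cmod p)\<^sup>2 \<noteq> 1"
    using assms(5) norm_ge_zero[of p] unfolding p_def[symmetric] power2_eq_1_iff by linarith
  then show ?thesis
    unfolding has_lorentz_curvature_def f_def[symmetric] p_def[symmetric] q_def[symmetric]
      h_def[symmetric]
    using gradient hessian
    by (rule_tac exI[of _ "g 1"], rule_tac exI[of _ "g \<i>"], rule_tac exI[of _ "s 1 1"],
        rule_tac exI[of _ "s 1 \<i>"], rule_tac exI[of _ "s \<i> \<i>"])
      (simp add: det gradient_norm del: times_complex.sel)
qed

text \<open>Multiplying by \<open>\<bar>F'\<^sup>2 - F F''\<bar>\<^sup>2\<close> turns \<open>Re (a / (b - a))\<close> into \<open>Re (a \<cdot> cnj (b - a))\<close>. So the sign
  of the curvature is that of the real part of a holomorphic function.\<close>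

lemma modular_surface_curvature_sign:
  assumes "open S" "F holomorphic_on S" "z \<in> S" "F z \<noteq> 0" "cmod (deriv F z) \<noteq> 1"
    and "(deriv F z)\<^sup>2 - F z * deriv (deriv F) z \<noteq> 0"
  shows "\<exists>d>0. has_lorentz_curvature (modular_surface F) z
    (- Re (F z * deriv (deriv F) z / ((deriv F z)\<^sup>2 - F z * deriv (deriv F) z)) * d)"
proof -
  define a c where "a = F z * deriv (deriv F) z" and "c = (deriv F z)\<^sup>2 - a"
  have "c \<noteq> 0"
    using assms(6) by (simp add: a_def c_def)
  have "a * cnj c = a / c * of_real ((cmod c)\<^sup>2)"
    using \<open>c \<noteq> 0\<close> by (simp add: complex_norm_square del: of_real_power)
  then have Re_eq: "Re (a * cnj c) = Re (a / c) * (cmod c)\<^sup>2"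
    by (simp del: times_divide_eq_left of_real_power)
  have "has_lorentz_curvature (modular_surface F) z (- Re (a / c) *
      ((cmod c)\<^sup>2 / ((cmod (F z))\<^sup>2 * (1 - (cmod (deriv F z))\<^sup>2)\<^sup>2)))"
    (is "has_lorentz_curvature _ _ (_ * ?d)")
    using modular_surface_curvature[OF assms(1-5)]
    unfolding a_def[symmetric] c_def[symmetric] Re_eq by simp
  moreover have "1 - (cmod (deriv F z))\<^sup>2 \<noteq> 0"
    using assms(5) norm_ge_zero[of "deriv F z"] power2_eq_1_iff[of "cmod (deriv F z)"] by linarith
  then have "?d > 0"
    using assms(4) \<open>c \<noteq> 0\<close> by simp
  ultimately show ?thesis
    unfolding c_def a_def by blast
qed

text \<open>At a zero of \<open>F\<close> the modulus is minimal, so a partial derivative there could only be \<open>0\<close>; but the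
  difference quotients of \<open>\<bar>F\<bar>\<close> have absolute values tending to \<open>\<bar>F'\<bar>\<close>.\<close>

lemma modular_surface_no_partial_x:
  assumes "(F has_field_derivative F') (at z)" "F z = 0" "F' \<noteq> 0"
  shows "\<not> has_partial_x (modular_surface F) d z"
proof
  assume *: "has_partial_x (modular_surface F) d z"
  define u where "u t = cmod (F (z + of_real t))" for t :: real
  have u: "(u has_real_derivative d) (at 0)"
    using * by (simp add: has_partial_x_def modular_surface_def u_def[abs_def])
  have "u 0 \<le> u t" for t
    by (simp add: u_def assms(2))
  then have "d = 0"
    using DERIV_local_min[OF u, of 1] by simp
  with u have "(\<lambda>t. u t / t) \<midarrow>0\<rightarrow> 0"
    by (simp add: DERIV_def u_def assms(2))
  then have "(\<lambda>t. \<bar>u t / t\<bar>) \<midarrow>0\<rightarrow> 0"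
    by (rule tendsto_rabs_zero)
  moreover have "(\<lambda>t. \<bar>u t / t\<bar>) \<midarrow>0\<rightarrow> cmod F'"
  proof -
    have "(\<lambda>h. F (z + h) / h) \<midarrow>0\<rightarrow> F'"
      using assms(1) by (simp add: DERIV_def assms(2))
    moreover have "filterlim complex_of_real (at 0) (at 0)"
      by (auto simp: filterlim_at eventually_at_filter intro!: tendsto_eq_intros)
    ultimately have "(\<lambda>t. F (z + of_real t) / of_real t) \<midarrow>0\<rightarrow> F'"
      by (rule filterlim_compose)
    from tendsto_norm[OF this] show ?thesis
      by (simp add: u_def norm_divide)
  qed
  ultimately show False
    using assms(3) LIM_unique by fastforce
qed

section \<open>A disc cut along the imaginary axis and its embeddings\<close>

text \<open>Only the sign of \<open>s\<close> matters in this and the next definition: \<open>1\<close> and \<open>-1\<close> select the right and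
  the left half disc, and the upper and the lower radius.\<close>

definition half_disc :: "real \<Rightarrow> real \<Rightarrow> complex set" where
  "half_disc s r = {w \<in> ball 0 r. s * Re w > 0}"

definition spoke :: "real \<Rightarrow> real \<Rightarrow> complex set" where
  "spoke s r = {w \<in> ball 0 r. Re w = 0 \<and> s * Im w > 0}"

lemma half_disc_subset: "half_disc s r \<subseteq> ball 0 r" and spoke_subset: "spoke s r \<subseteq> ball 0 r"
  by (auto simp: half_disc_def spoke_def)

lemma disc_decomposition:
  "ball 0 r - {0} = half_disc (-1) r \<union> half_disc 1 r \<union> spoke 1 r \<union> spoke (-1) r"
  by (auto simp: half_disc_def spoke_def complex_eq_iff)

lemma half_disc_open_connected:
  shows "open (half_disc s r)" "connected (half_disc s r)"
proof -
  have eq: "half_disc s r = ball 0 r \<inter> {w. complex_of_real s \<bullet> w > 0}"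
    by (auto simp: half_disc_def inner_complex_def)
  show "open (half_disc s r)"
    unfolding eq by (intro open_Int open_ball open_halfspace_gt)
  show "connected (half_disc s r)"
    unfolding eq by (intro convex_connected convex_Int convex_ball convex_halfspace_gt)
qed

lemma half_disc_nonempty:
  assumes "r > 0" "s \<noteq> 0"
  shows "half_disc s r \<noteq> {}"
proof -
  have "of_real (sgn s * r / 2) \<in> half_disc s r"
    using assms by (auto simp: half_disc_def norm_mult sgn_if abs_mult mult_neg_pos)
  then show ?thesis by auto
qed

lemma spoke_subset_closure_half_disc:
  assumes "s \<noteq> 0"
  shows "spoke s' r \<subseteq> closure (half_disc s r)"
proof
  fix w assume w: "w \<in> spoke s' r"
  have lim: "((\<lambda>t. w + of_real (s * t)) \<longlongrightarrow> w) (at_right 0)"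
    by (auto intro!: tendsto_eq_intros)
  have "\<forall>\<^sub>F t in at_right 0. w + of_real (s * t) \<in> ball 0 r"
    using w by (intro topological_tendstoD[OF lim]) (auto simp: spoke_def)
  then have "\<forall>\<^sub>F t in at_right 0. w + of_real (s * t) \<in> half_disc s r"
    using eventually_at_right_less[of "0::real"]
  proof eventually_elim
    case (elim t)
    then show ?case
      using w assms by (auto simp: half_disc_def spoke_def zero_less_mult_iff mult_neg_pos)
  qed
  then have "\<forall>\<^sub>F t in at_right 0. w + of_real (s * t) \<in> closure (half_disc s r)"
    by eventually_elim (use closure_subset in blast)
  then show "w \<in> closure (half_disc s r)"
    by (rule Lim_in_closed_set[OF closed_closure _ trivial_limit_at_right_real lim])
qed

context
  fixes \<phi> :: "complex \<Rightarrow> complex" and r :: real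
  assumes r: "r > 0"
    and cont: "continuous_on (cball 0 r) \<phi>"
    and inj: "inj_on \<phi> (cball 0 r)"
begin

lemma open_image_subset_disc:
  assumes "open A" "A \<subseteq> ball 0 r"
  shows "open (\<phi> ` A)"
proof (rule invariance_of_domain)
  have "A \<subseteq> cball 0 r"
    using assms(2) ball_subset_cball by blast
  then show "continuous_on A \<phi>" "inj_on \<phi> A"
    using cont inj continuous_on_subset inj_on_subset by blast+
qed fact

lemma image_disjoint_iff:
  assumes "A \<subseteq> cball 0 r" "B \<subseteq> cball 0 r"
  shows "\<phi> ` A \<inter> \<phi> ` B = {} \<longleftrightarrow> A \<inter> B = {}"
  using inj_on_image_Int[OF inj assms] by auto

text \<open>The two half discs have disjoint open images, so neither image has frontier points in the other.
  Conversely each point of the open radii is a limit of points of either half disc, which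
  continuity of \<open>\<phi>\<close> carries over to the images.\<close>

lemma frontier_image_half_disc:
  assumes "s = 1 \<or> s = -1"
  shows "frontier (\<phi> ` half_disc s r) \<inter> (\<phi> ` ball 0 r - {\<phi> 0}) = \<phi> ` spoke 1 r \<union> \<phi> ` spoke (-1) r"
    (is "?L = ?R")
proof
  have open_image: "open (\<phi> ` half_disc t r)" for t
    by (intro open_image_subset_disc half_disc_open_connected half_disc_subset)
  have frontier_eq: "frontier (\<phi> ` half_disc s r) = closure (\<phi> ` half_disc s r) - \<phi> ` half_disc s r"
    using open_image by (simp add: frontier_def interior_open)
  have disc_sub: "A \<subseteq> cball 0 r" if "A \<subseteq> ball 0 r" for A :: "complex set"
    using that ball_subset_cball by blast
  have "half_disc s r \<inter> half_disc (-s) r = {}"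
    by (auto simp: half_disc_def)
  then have "\<phi> ` half_disc s r \<inter> \<phi> ` half_disc (-s) r = {}"
    by (simp add: image_disjoint_iff disc_sub half_disc_subset)
  then have opposite: "closure (\<phi> ` half_disc s r) \<inter> \<phi> ` half_disc (-s) r = {}"
    using open_image by (metis open_Int_closure_eq_empty inf_commute)
  show "?L \<subseteq> ?R"
  proof
    fix z assume z: "z \<in> ?L"
    then obtain w where w: "w \<in> ball 0 r" "z = \<phi> w" "w \<noteq> 0"
      by blast
    then have "w \<in> ball 0 r - {0}" by simp
    moreover have "w \<notin> half_disc s r" "w \<notin> half_disc (-s) r"
      using z w opposite unfolding frontier_eq by blast+
    ultimately have "w \<in> spoke 1 r \<union> spoke (-1) r"
      unfolding disc_decomposition using assms by auto
    with w show "z \<in> ?R" by blast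
  qed
  have "\<phi> ` spoke t r \<subseteq> ?L" for t
  proof -
    have sub: "spoke t r \<subseteq> cball 0 r" "half_disc s r \<subseteq> cball 0 r" "{0} \<subseteq> cball 0 r"
      using r by (auto simp: disc_sub half_disc_subset spoke_subset)
    have "spoke t r \<inter> half_disc s r = {}" "spoke t r \<inter> {0} = {}"
      by (auto simp: half_disc_def spoke_def)
    then have "\<phi> ` spoke t r \<inter> \<phi> ` half_disc s r = {}" "\<phi> ` spoke t r \<inter> \<phi> ` {0} = {}"
      using sub image_disjoint_iff by metis+
    then have "\<phi> ` spoke t r \<inter> \<phi> ` half_disc s r = {}" "\<phi> ` spoke t r \<inter> {\<phi> 0} = {}"
      by simp_all
    moreover have "\<phi> ` spoke t r \<subseteq> closure (\<phi> ` half_disc s r)"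
    proof -
      have "closure (half_disc s r) \<subseteq> cball 0 r"
        using sub by (simp add: closure_minimal)
      then have "\<phi> ` closure (half_disc s r) \<subseteq> closure (\<phi> ` half_disc s r)"
        by (intro image_closure_subset continuous_on_subset[OF cont] closed_closure closure_subset)
      moreover have "spoke t r \<subseteq> closure (half_disc s r)"
        using assms by (intro spoke_subset_closure_half_disc) auto
      ultimately show ?thesis by blast
    qed
    moreover have "\<phi> ` spoke t r \<subseteq> \<phi> ` ball 0 r"
      using spoke_subset by (rule image_mono)
    ultimately show ?thesis
      unfolding frontier_eq by blast
  qed
  then show "?R \<subseteq> ?L" by simp
qed

text \<open>Here the embedding of the closed disc, and not just of the open one, matters: the image of a radius
  has an end point, which injectivity keeps outside the image of the open disc.\<close>

lemma spoke_image_arc: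
  assumes "s = 1 \<or> s = -1"
  defines "\<gamma> \<equiv> \<lambda>t. \<phi> (\<i> * of_real (s * r * t))"
  shows "arc \<gamma>" "pathstart \<gamma> = \<phi> 0" "pathfinish \<gamma> \<in> frontier (\<phi> ` ball 0 r)"
    "\<gamma> ` {0<..<1} = \<phi> ` spoke s r"
proof -
  define l :: "real \<Rightarrow> complex" where "l t = \<i> * of_real (s * r * t)" for t
  have \<gamma>: "\<gamma> = \<phi> \<circ> l"
    by (simp add: \<gamma>_def l_def fun_eq_iff)
  have abs_s: "\<bar>s\<bar> = 1" "s * s = 1"
    using assms(1) by auto
  have norm_l: "cmod (l t) = r * \<bar>t\<bar>" for t
    using r abs_s by (simp add: l_def norm_mult abs_mult)
  have l_cball: "l ` {0..1} \<subseteq> cball 0 r"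
    using r by (auto simp: norm_l mult_left_le)
  have inj_l: "inj_on l {0..1}"
    using r abs_s by (auto simp: inj_on_def l_def)
  show "arc \<gamma>"
    unfolding arc_def path_def \<gamma>
  proof
    show "continuous_on {0..1} (\<phi> \<circ> l)"
      by (intro continuous_on_compose continuous_on_subset[OF cont l_cball])
        (auto simp: l_def[abs_def] intro!: continuous_intros)
    show "inj_on (\<phi> \<circ> l) {0..1}"
      by (intro comp_inj_on inj_l inj_on_subset[OF inj l_cball])
  qed
  show "pathstart \<gamma> = \<phi> 0"
    by (simp add: pathstart_def \<gamma>_def)
  have "l 1 \<in> cball 0 r" "l 1 \<notin> ball 0 r"
    using r by (simp_all add: norm_l)
  then have "\<phi> (l 1) \<notin> \<phi> ` ball 0 r"
    using inj ball_subset_cball by (fastforce simp: inj_on_def)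
  moreover have "\<phi> ` cball 0 r \<subseteq> closure (\<phi> ` ball 0 r)"
    using image_closure_subset[OF _ closed_closure closure_subset, of "ball 0 r" \<phi>] cont r
    by (simp add: closure_ball)
  ultimately show "pathfinish \<gamma> \<in> frontier (\<phi> ` ball 0 r)"
    using \<open>l 1 \<in> cball 0 r\<close> open_image_subset_disc[of "ball 0 r"]
    by (auto simp: pathfinish_def \<gamma> frontier_def interior_open)
  have "l ` {0<..<1} = spoke s r"
  proof
    show "l ` {0<..<1} \<subseteq> spoke s r"
    proof
      fix w assume "w \<in> l ` {0<..<1}"
      then obtain t where t: "0 < t" "t < 1" "w = l t" by auto
      moreover have "s * Im (l t) = r * t"
        using abs_s by (simp add: l_def mult.assoc[symmetric])
      ultimately show "w \<in> spoke s r"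
        using r by (simp add: spoke_def norm_l) (simp add: l_def)
    qed
    show "spoke s r \<subseteq> l ` {0<..<1}"
    proof
      fix w assume w: "w \<in> spoke s r"
      have "w = l (s * Im w / r)"
        using w r abs_s by (auto simp: spoke_def l_def complex_eq_iff mult.assoc[symmetric])
      moreover have "s * Im w < r"
        using w assms(1) abs_Im_le_cmod[of w] by (auto simp: spoke_def)
      then have "s * Im w / r \<in> {0<..<1}"
        using w r by (auto simp: spoke_def)
      ultimately show "w \<in> l ` {0<..<1}" by blast
    qed
  qed
  then show "\<gamma> ` {0<..<1} = \<phi> ` spoke s r"
    unfolding \<gamma> image_comp[symmetric] by simp
qed

end

section \<open>The curvature near a simple zero\<close>

lemma local_inverse_on_disc:
  assumes "open S" "z \<in> S" "H holomorphic_on S" "deriv H z \<noteq> 0"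
  obtains \<phi> r where "r > 0" "continuous_on (cball (H z) r) \<phi>" "\<phi> ` cball (H z) r \<subseteq> S"
    "\<phi> (H z) = z" "\<And>w. w \<in> cball (H z) r \<Longrightarrow> H (\<phi> w) = w"
proof -
  obtain \<rho> where \<rho>: "\<rho> > 0" "ball z \<rho> \<subseteq> S" "open (H ` ball z \<rho>)" "inj_on H (ball z \<rho>)"
    using has_complex_derivative_locally_invertible[OF assms(3,2,1,4)] .
  obtain \<phi> where \<phi>: "\<phi> holomorphic_on H ` ball z \<rho>" "\<And>y. y \<in> ball z \<rho> \<Longrightarrow> \<phi> (H y) = y"
    using holomorphic_has_inverse[OF holomorphic_on_subset[OF assms(3) \<rho>(2)] open_ball \<rho>(4)] by metis
  have "H z \<in> H ` ball z \<rho>"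
    using \<rho>(1) by simp
  then obtain r where r: "r > 0" "cball (H z) r \<subseteq> H ` ball z \<rho>"
    using \<rho>(3) open_contains_cball by blast
  show thesis
  proof
    show "continuous_on (cball (H z) r) \<phi>"
      using \<phi>(1) r(2) continuous_on_subset holomorphic_on_imp_continuous_on by blast
    show "\<phi> ` cball (H z) r \<subseteq> S"
      using r(2) \<rho>(2) \<phi>(2) by (smt (verit) image_iff subset_iff)
    show "\<phi> (H z) = z"
      using \<phi>(2) \<rho>(1) by simp
    show "H (\<phi> w) = w" if "w \<in> cball (H z) r" for w
      using that r(2) \<phi>(2) by force
  qed fact
qed

theorem proposition3p5:
  fixes F :: "complex \<Rightarrow> complex" and U :: "complex set"
  assumes "open U" and "0 \<in> U"
    and "F analytic_on U"
    and "\<forall>z\<in>U. cmod (deriv F z) \<noteq> 1"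
    and "F 0 = 0"
    and "deriv F 0 \<noteq> 0"
    and "deriv (deriv F) 0 \<noteq> 0"
  shows "(\<nexists>k. has_lorentz_curvature (modular_surface F) 0 k) \<and>
    (\<exists>V P N \<gamma>\<^sub>1 \<gamma>\<^sub>2 C\<^sub>1 C\<^sub>2.
      open V \<and> 0 \<in> V \<and> V \<subseteq> U \<and>
      open P \<and> connected P \<and> P \<noteq> {} \<and>
      open N \<and> connected N \<and> N \<noteq> {} \<and>
      arc \<gamma>\<^sub>1 \<and> pathstart \<gamma>\<^sub>1 = 0 \<and> pathfinish \<gamma>\<^sub>1 \<in> frontier V \<and> C\<^sub>1 = \<gamma>\<^sub>1 ` {0<..<1} \<and>
      arc \<gamma>\<^sub>2 \<and> pathstart \<gamma>\<^sub>2 = 0 \<and> pathfinish \<gamma>\<^sub>2 \<in> frontier V \<and> C\<^sub>2 = \<gamma>\<^sub>2 ` {0<..<1} \<and>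
      V - {0} = P \<union> N \<union> C\<^sub>1 \<union> C\<^sub>2 \<and>
      P \<inter> N = {} \<and> (P \<union> N) \<inter> (C\<^sub>1 \<union> C\<^sub>2) = {} \<and> C\<^sub>1 \<inter> C\<^sub>2 = {} \<and>
      frontier P \<inter> (V - {0}) = C\<^sub>1 \<union> C\<^sub>2 \<and>
      frontier N \<inter> (V - {0}) = C\<^sub>1 \<union> C\<^sub>2 \<and>
      (\<forall>z\<in>P. \<exists>k>0. has_lorentz_curvature (modular_surface F) z k) \<and>
      (\<forall>z\<in>N. \<exists>k<0. has_lorentz_curvature (modular_surface F) z k) \<and>
      (\<forall>z\<in>C\<^sub>1 \<union> C\<^sub>2. has_lorentz_curvature (modular_surface F) z 0))"
proof -
  have hol: "F holomorphic_on U"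
    using assms(3) analytic_imp_holomorphic by blast
  then have hol': "deriv F holomorphic_on U" "deriv (deriv F) holomorphic_on U"
    using assms(1) holomorphic_deriv by blast+
  have D0: "(F has_field_derivative deriv F 0) (at 0)"
    using hol assms(1,2) holomorphic_derivI by blast
  define c where "c z = (deriv F z)\<^sup>2 - F z * deriv (deriv F) z" for z
  define H where "H z = F z * deriv (deriv F) z / c z" for z
  define S where "S = {z \<in> U. c z \<noteq> 0}"
  have hol_c: "c holomorphic_on U"
    unfolding c_def by (intro holomorphic_intros hol hol')
  have "open S"
  proof -
    have "S = U \<inter> c -` (- {0})"
      by (auto simp: S_def)
    then show ?thesis
      using continuous_open_preimage[OF holomorphic_on_imp_continuous_on[OF hol_c] assms(1), of "- {0}"]
      by (simp add: open_Compl)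
  qed
  have "0 \<in> S"
    using assms by (simp add: S_def c_def)
  have c_nz: "c z \<noteq> 0" if "z \<in> S" for z
    using that by (auto simp: S_def)
  have hol_H: "H holomorphic_on S"
    unfolding H_def using c_nz S_def
    by (intro holomorphic_intros holomorphic_on_subset[OF hol] holomorphic_on_subset[OF hol_c]
        holomorphic_on_subset[OF hol'(2)]) auto
  have "H 0 = 0"
    by (simp add: H_def assms)
  have "deriv H 0 \<noteq> 0"
  proof -
    have "(deriv (deriv F) has_field_derivative deriv (deriv (deriv F)) 0) (at 0)"
      and "(c has_field_derivative deriv c 0) (at 0)"
      using hol' hol_c assms(1,2) holomorphic_derivI by blast+
    \<comment> \<open>Because \<open>F 0 = 0\<close>, the third derivative of \<open>F\<close> and the derivative of \<open>c\<close> drop out.\<close>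
    from DERIV_divide[OF DERIV_mult[OF D0 this(1)] this(2)]
    have "(H has_field_derivative deriv F 0 * deriv (deriv F) 0 / c 0) (at 0)"
      using c_nz[OF \<open>0 \<in> S\<close>] unfolding H_def by (simp add: assms)
    then show ?thesis
      using c_nz[OF \<open>0 \<in> S\<close>] assms by (simp add: DERIV_imp_deriv)
  qed
  have curvature: "\<exists>d>0. has_lorentz_curvature (modular_surface F) z (- Re (H z) * d)"
    if "z \<in> S" "H z \<noteq> 0" for z
  proof -
    have "z \<in> U" "F z \<noteq> 0"
      using that by (auto simp: H_def S_def)
    moreover have "cmod (deriv F z) \<noteq> 1"
      using assms(4) \<open>z \<in> U\<close> by blast
    ultimately show ?thesis
      using modular_surface_curvature_sign[OF assms(1) hol] c_nz[OF that(1)]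
      unfolding H_def c_def by blast
  qed
  obtain \<phi> r where r: "r > 0" and cont: "continuous_on (cball 0 r) \<phi>"
    and \<phi>S: "\<phi> ` cball 0 r \<subseteq> S" and \<phi>0: "\<phi> 0 = 0" and H\<phi>: "\<And>w. w \<in> cball 0 r \<Longrightarrow> H (\<phi> w) = w"
    using local_inverse_on_disc[OF \<open>open S\<close> \<open>0 \<in> S\<close> hol_H \<open>deriv H 0 \<noteq> 0\<close>] unfolding \<open>H 0 = 0\<close> by metis
  have inj: "inj_on \<phi> (cball 0 r)"
    using H\<phi> by (metis inj_on_inverseI)
  note spoke_arc = spoke_image_arc[OF r cont inj, unfolded \<phi>0]
  note frontier_half = frontier_image_half_disc[OF r cont inj, unfolded \<phi>0]
  note open_image = open_image_subset_disc[OF r cont inj]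
  have disjoint: "\<phi> ` A \<inter> \<phi> ` B = {}" if "A \<inter> B = {}" "A \<subseteq> ball 0 r" "B \<subseteq> ball 0 r" for A B
    using image_disjoint_iff[OF r cont inj, of A B] that ball_subset_cball by blast
  have "connected (\<phi> ` half_disc s r)" for s
    by (meson cont continuous_on_subset ball_subset_cball half_disc_subset order_trans
        connected_continuous_image half_disc_open_connected(2))
  have punctured: "\<phi> ` ball 0 r - {0} = \<phi> ` (ball 0 r - {0})"
  proof -
    have "ball 0 r - {0} \<subseteq> cball 0 r" "{0} \<subseteq> cball 0 r"
      using r by auto
    from inj_on_image_set_diff[OF inj this] show ?thesis
      by (simp add: \<phi>0)
  qed
  \<comment> \<open>Since \<open>H (\<phi> w) = w\<close>, the coordinate \<open>w\<close> itself decides the sign of the curvature.\<close>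
  have K: "\<exists>d>0. has_lorentz_curvature (modular_surface F) (\<phi> w) (- Re w * d)"
    if "w \<in> ball 0 r" "w \<noteq> 0" for w
    using curvature[of "\<phi> w"] that H\<phi>[of w] \<phi>S by (auto simp: image_subset_iff)
  have positive: "\<forall>z\<in>\<phi> ` half_disc (-1) r. \<exists>k>0. has_lorentz_curvature (modular_surface F) z k"
  proof (rule ballI, erule imageE, hypsubst)
    fix w assume w: "w \<in> half_disc (-1) r"
    then have "w \<in> ball 0 r" "w \<noteq> 0" "Re w < 0"
      by (auto simp: half_disc_def)
    then obtain d where "d > 0" "has_lorentz_curvature (modular_surface F) (\<phi> w) (- Re w * d)"
      using K by blast
    moreover have "- Re w * d > 0"
      using \<open>d > 0\<close> \<open>Re w < 0\<close> by (intro mult_pos_pos) auto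
    ultimately show "\<exists>k>0. has_lorentz_curvature (modular_surface F) (\<phi> w) k"
      by blast
  qed
  have negative: "\<forall>z\<in>\<phi> ` half_disc 1 r. \<exists>k<0. has_lorentz_curvature (modular_surface F) z k"
  proof (rule ballI, erule imageE, hypsubst)
    fix w assume w: "w \<in> half_disc 1 r"
    then have "w \<in> ball 0 r" "w \<noteq> 0" "Re w > 0"
      by (auto simp: half_disc_def)
    then obtain d where "d > 0" "has_lorentz_curvature (modular_surface F) (\<phi> w) (- Re w * d)"
      using K by blast
    moreover have "- Re w * d < 0"
      using \<open>d > 0\<close> \<open>Re w > 0\<close> by (intro mult_neg_pos) auto
    ultimately show "\<exists>k<0. has_lorentz_curvature (modular_surface F) (\<phi> w) k"
      by blast
  qed
  have zero: "\<forall>z\<in>\<phi> ` spoke 1 r \<union> \<phi> ` spoke (-1) r. has_lorentz_curvature (modular_surface F) z 0"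
  proof -
    have "has_lorentz_curvature (modular_surface F) (\<phi> w) 0" if "w \<in> spoke s r" for s w
    proof -
      have "w \<in> ball 0 r" "w \<noteq> 0" and Re: "Re w = 0"
        using that by (auto simp: spoke_def)
      then obtain d where "has_lorentz_curvature (modular_surface F) (\<phi> w) (- Re w * d)"
        using K by blast
      then show ?thesis by (simp add: Re)
    qed
    then show ?thesis by blast
  qed
  have "\<phi> ` ball 0 r \<subseteq> U"
    using \<phi>S ball_subset_cball unfolding S_def by blast
  have "0 \<in> \<phi> ` ball 0 r"
    using r \<phi>0 by (metis centre_in_ball image_eqI)
  have disj: "\<phi> ` half_disc (-1) r \<inter> \<phi> ` half_disc 1 r = {}"
    "(\<phi> ` half_disc (-1) r \<union> \<phi> ` half_disc 1 r) \<inter> (\<phi> ` spoke 1 r \<union> \<phi> ` spoke (-1) r) = {}"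
    "\<phi> ` spoke 1 r \<inter> \<phi> ` spoke (-1) r = {}"
    unfolding image_Un[symmetric]
    by (intro disjoint; use half_disc_subset spoke_subset in \<open>auto simp: half_disc_def spoke_def\<close>)+
  have no_curvature: "\<nexists>k. has_lorentz_curvature (modular_surface F) 0 k"
  proof
    assume "\<exists>k. has_lorentz_curvature (modular_surface F) 0 k"
    then obtain hx hy where
      "\<forall>\<^sub>F w in nhds 0. has_partial_x (modular_surface F) (hx w) w \<and> has_partial_y (modular_surface F) (hy w) w"
      unfolding has_lorentz_curvature_def by blast
    then have "has_partial_x (modular_surface F) (hx 0) 0"
      using eventually_nhds_x_imp_x by blast
    then show False
      using modular_surface_no_partial_x[OF D0 assms(5,6)] by blast
  qed
  show ?thesis
  proof (rule conjI[OF no_curvature], rule exI[of _ "\<phi> ` ball 0 r"], rule exI[of _ "\<phi> ` half_disc (-1) r"],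
      rule exI[of _ "\<phi> ` half_disc 1 r"],
      rule exI[of _ "\<lambda>t. \<phi> (\<i> * of_real (1 * r * t))"],
      rule exI[of _ "\<lambda>t. \<phi> (\<i> * of_real (-1 * r * t))"],
      rule exI[of _ "\<phi> ` spoke 1 r"], rule exI[of _ "\<phi> ` spoke (-1) r"], intro conjI)
    show "open (\<phi> ` ball 0 r)" "open (\<phi> ` half_disc (-1) r)" "open (\<phi> ` half_disc 1 r)"
      by (intro open_image open_ball half_disc_open_connected half_disc_subset order_refl)+
    show "\<phi> ` half_disc (-1) r \<noteq> {}" "\<phi> ` half_disc 1 r \<noteq> {}"
      using r half_disc_nonempty by simp_all
    show "\<phi> ` ball 0 r - {0} = \<phi> ` half_disc (-1) r \<union> \<phi> ` half_disc 1 r \<union> \<phi> ` spoke 1 r \<union> \<phi> ` spoke (-1) r"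
      unfolding punctured disc_decomposition image_Un ..
  qed (fact | rule spoke_arc spoke_arc(4)[symmetric] frontier_half, simp; fail)+
qed

end
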